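(* Let $G$ be a connected finite simple graph on $n\ge 1$ vertices. Then $noc(G)\le 2^{n-1}+n$. Moreover, equality holds if and only if $G$ is isomorphic to the star $K_{1,n-1}$, the path $P_4$, or the path $P_5$.
   Context: For a finite simple undirected graph $G=(V,E)$, a set $S\subseteq V$ is called $P_3$-convex if for every path $x$--$z$--$y$ in $G$ (distinct vertices $x,z,y$ with $xz,zy\in E$) with $x,y\in S$, we also have $z\in S$. The number $noc(G)$ denotes the number of $P_3$-convex subsets of $V$ (including $\emptyset$). $K_{1,n-1}$ is the star on $n$ vertices and $P_k$ the path on $k$ vertices. *)

theory Defs
  imports "Graph_Theory.Graph_Theory"
begin

text \<open>
  A finite simple undirected graph is a \<^locale>\<open>graph\<close>: a finite, loop-free digraph without
  parallel arcs whose arc relation is symmetric, so every edge is a pair of opposite arcs.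
\<close>

definition P3_convex :: "('a, 'b) pre_digraph \<Rightarrow> 'a set \<Rightarrow> bool" where
  "P3_convex G S \<longleftrightarrow> S \<subseteq> verts G \<and>
     (\<forall>x z y. distinct [x, z, y] \<and> x \<rightarrow>\<^bsub>G\<^esub> z \<and> z \<rightarrow>\<^bsub>G\<^esub> y \<and> x \<in> S \<and> y \<in> S \<longrightarrow> z \<in> S)"

definition noc :: "('a, 'b) pre_digraph \<Rightarrow> nat" where
  "noc G = card {S. P3_convex G S}"

text \<open>The star \<open>K\<close> with parts of sizes \<open>1\<close> and \<open>n - 1\<close>; its centre is \<open>0\<close>.\<close>

definition star_graph :: "nat \<Rightarrow> nat pair_pre_digraph" where
  "star_graph n = \<lparr> pverts = {..<n},
     parcs = {(u, v). u < n \<and> v < n \<and> u \<noteq> v \<and> (u = 0 \<or> v = 0)} \<rparr>"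

definition path_graph :: "nat \<Rightarrow> nat pair_pre_digraph" where
  "path_graph k = \<lparr> pverts = {..<k},
     parcs = {(u, v). u < k \<and> v < k \<and> (v = Suc u \<or> u = Suc v)} \<rparr>"

lemma pair_graph_star_graph: "pair_graph (star_graph n)"
proof -
  have "parcs (star_graph n) \<subseteq> {..<n} \<times> {..<n}"
    by (auto simp: star_graph_def)
  then have "finite (parcs (star_graph n))"
    by (rule finite_subset) simp
  then show ?thesis
    by unfold_locales (auto simp: star_graph_def symmetric_def sym_def)
qed

lemma pair_graph_path_graph: "pair_graph (path_graph k)"
proof -
  have "parcs (path_graph k) \<subseteq> {..<k} \<times> {..<k}"
    by (auto simp: path_graph_def)
  then have "finite (parcs (path_graph k))"
    by (rule finite_subset) simp
  then show ?thesis
    by unfold_locales (auto simp: path_graph_def symmetric_def sym_def)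
qed

lemma star_graph_complete_bipartite:
  assumes "n \<ge> 1"
  shows "complete_bipartite_digraph 1 (n - 1) (with_proj (star_graph n))"
  unfolding complete_bipartite_digraph_def
proof (intro conjI exI)
  show "graph (with_proj (star_graph n))"
    by (rule pair_graph.pair_graphD_graph[OF pair_graph_star_graph])
  show "verts (with_proj (star_graph n)) = {0} \<union> {1..<n}"
    using assms by (auto simp: star_graph_def)
  show "arcs_ends (with_proj (star_graph n)) = {0} \<times> {1..<n} \<union> {1..<n} \<times> {0}"
    using assms by (auto simp: star_graph_def)
qed auto

text \<open>
  The library's isomorphism relation, which also maps arcs, agrees on simple graphs with the
  existence of an adjacency-preserving and -reflecting bijection of the vertices.
\<close>

lemma digraph_iso_pair_graph_iff:
  fixes G :: "('a, 'b) pre_digraph" and H :: "'c pair_pre_digraph"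
  assumes "graph G" and "pair_graph H"
  shows "digraph_iso G (with_proj H) \<longleftrightarrow>
    (\<exists>f. bij_betw f (verts G) (pverts H) \<and>
       (\<forall>u \<in> verts G. \<forall>v \<in> verts G. u \<rightarrow>\<^bsub>G\<^esub> v \<longleftrightarrow> (f u, f v) \<in> parcs H))"
    (is "?L \<longleftrightarrow> ?R")
proof
  interpret G: graph G by fact
  {
    assume ?L
    then obtain h where h: "G.digraph_isomorphism h" and H: "with_proj H = app_iso h G"
      unfolding digraph_iso_def by blast
    have ia: "inj_on (iso_verts h) (verts G)"
      and ends: "\<And>a. a \<in> arcs G \<Longrightarrow> iso_tail h (iso_arcs h a) = iso_verts h (tail G a) \<and>
                   iso_head h (iso_arcs h a) = iso_verts h (head G a)"
      using h by (auto simp: G.digraph_isomorphism_def)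
    have V: "pverts H = iso_verts h ` verts G"
      using arg_cong[OF H, of verts] by (simp add: verts_app_iso)
    have "parcs H = arcs_ends (app_iso h G)"
      by (simp flip: H)
    also have "\<dots> = (\<lambda>a. (iso_verts h (tail G a), iso_verts h (head G a))) ` arcs G"
      by (auto simp: arcs_ends_conv app_iso_def ends image_iff)
    finally have A: "parcs H = (\<lambda>a. (iso_verts h (tail G a), iso_verts h (head G a))) ` arcs G" .
    have "u \<rightarrow>\<^bsub>G\<^esub> v \<longleftrightarrow> (iso_verts h u, iso_verts h v) \<in> parcs H"
      if "u \<in> verts G" "v \<in> verts G" for u v
      using that ia by (auto simp: A arcs_ends_conv image_iff inj_on_eq_iff)
    then show ?R
      using ia V by (intro exI[of _ "iso_verts h"]) (auto simp: bij_betw_def)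
  }
  {
    interpret H: pair_graph H by fact
    assume ?R
    then obtain f where bij: "bij_betw f (verts G) (pverts H)"
      and adj: "\<And>u v. u \<in> verts G \<Longrightarrow> v \<in> verts G \<Longrightarrow> u \<rightarrow>\<^bsub>G\<^esub> v \<longleftrightarrow> (f u, f v) \<in> parcs H"
      by blast
    define h where "h = \<lparr> iso_verts = f, iso_arcs = (\<lambda>a. (f (tail G a), f (head G a))),
      iso_head = snd, iso_tail = fst \<rparr>"
    have inj: "inj_on f (verts G)" and im: "f ` verts G = pverts H"
      using bij by (auto simp: bij_betw_def)
    have "inj_on (\<lambda>a. (f (tail G a), f (head G a))) (arcs G)"
      using inj by (auto intro!: inj_onI G.no_multi_arcs simp: arc_to_ends_def inj_on_eq_iff)
    then have "G.digraph_isomorphism h"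
      using inj by (simp add: G.digraph_isomorphism_def h_def G.wf_digraph)
    moreover have "(\<lambda>a. (f (tail G a), f (head G a))) ` arcs G = parcs H"
    proof (intro equalityI subsetI)
      fix e assume "e \<in> (\<lambda>a. (f (tail G a), f (head G a))) ` arcs G"
      then obtain a where a: "a \<in> arcs G" "e = (f (tail G a), f (head G a))"
        by blast
      then have "tail G a \<rightarrow>\<^bsub>G\<^esub> head G a"
        by (auto simp: arcs_ends_conv)
      then show "e \<in> parcs H"
        using adj a by simp
    next
      fix e assume e: "e \<in> parcs H"
      then have "fst e \<in> f ` verts G" "snd e \<in> f ` verts G"
        unfolding im by (auto simp: H.arc_fst_in_verts H.arc_snd_in_verts)
      then obtain u v where uv: "u \<in> verts G" "v \<in> verts G" "e = (f u, f v)"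
        by (metis imageE prod.collapse)
      then have "u \<rightarrow>\<^bsub>G\<^esub> v"
        using adj e by blast
      then show "e \<in> (\<lambda>a. (f (tail G a), f (head G a))) ` arcs G"
        using uv(3) by (auto simp: arcs_ends_conv)
    qed
    then have "with_proj H = app_iso h G"
      using im by (simp add: app_iso_def h_def with_proj_def)
    ultimately show ?L
      unfolding digraph_iso_def by blast
  }
qed

end

theory Submission
  imports Defs
begin

text \<open>
  Attaching a leaf \<open>v\<close> to a vertex \<open>w\<close> of a tree \<open>T\<close> gives
  \<open>noc (T + v) = 2 * noc T - b\<close>, where \<open>b\<close> counts the convex sets of \<open>T\<close> that avoid \<open>w\<close> but
  contain a neighbour of \<open>w\<close>: these are exactly the ones that \<open>v\<close> cannot join. A tree on \<open>m\<close>
  vertices has \<open>b \<ge> m - 1\<close>, because the paths starting at a neighbour of \<open>w\<close> and leading away from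
  \<open>w\<close> are such sets. The bound for trees follows by induction, and equality forces \<open>T\<close> to be
  extremal with \<open>b = m - 1\<close>; inspection of the extremal trees leaves only the centre of a star,
  a leaf of a star on at most three vertices, and an end of \<open>P\<^sub>4\<close>.

  For a graph \<open>G\<close> with spanning tree \<open>T\<close>, every convex set of \<open>G\<close> is convex in \<open>T\<close>. If \<open>xy\<close>
  is an edge of \<open>G\<close> but not of \<open>T\<close>, then a convex set of \<open>T\<close> that avoids \<open>x\<close> and contains
  \<open>y\<close> and a \<open>T\<close>-neighbour of \<open>x\<close> is not convex in \<open>G\<close>, so the inequality is strict.
\<close>

section \<open>Convex sets and isomorphisms\<close>

text \<open>Only \<open>x \<noteq> y\<close> is demanded: if \<open>z\<close> equals
  \<open>x\<close> or \<open>y\<close>, the conclusion is trivial, so this agrees with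
  \<open>P3_convex\<close>. A plain vertex set and relation make it easy to grow a graph vertex by
  vertex.\<close>

definition convex_sets :: "'a set \<Rightarrow> 'a rel \<Rightarrow> 'a set set" where
  "convex_sets V R = {S. S \<subseteq> V \<and>
     (\<forall>x\<in>S. \<forall>y\<in>S. \<forall>z\<in>V. (x, z) \<in> R \<and> (z, y) \<in> R \<and> x \<noteq> y \<longrightarrow> z \<in> S)}"

lemma convex_setsI:
  assumes "S \<subseteq> V"
    and "\<And>x y z. x \<in> S \<Longrightarrow> y \<in> S \<Longrightarrow> z \<in> V \<Longrightarrow> (x, z) \<in> R \<Longrightarrow> (z, y) \<in> R \<Longrightarrow> x \<noteq> y \<Longrightarrow> z \<in> S"
  shows "S \<in> convex_sets V R"
  using assms unfolding convex_sets_def by blast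

lemma convex_setsD:
  assumes "S \<in> convex_sets V R" "x \<in> S" "y \<in> S" "z \<in> V" "(x, z) \<in> R" "(z, y) \<in> R" "x \<noteq> y"
  shows "z \<in> S"
  using assms unfolding convex_sets_def by blast

text \<open>The cardinality of this family is the defect \<open>b\<close> incurred when a leaf is
  attached to \<open>w\<close>.\<close>

definition touching_sets :: "'a set \<Rightarrow> 'a rel \<Rightarrow> 'a \<Rightarrow> 'a set set" where
  "touching_sets V R w = {S \<in> convex_sets V R. w \<notin> S \<and> (\<exists>x\<in>S. (w, x) \<in> R)}"

definition rel_iso :: "('a \<Rightarrow> 'b) \<Rightarrow> 'a set \<Rightarrow> 'a rel \<Rightarrow> 'b set \<Rightarrow> 'b rel \<Rightarrow> bool" where
  "rel_iso f V R V' R' \<longleftrightarrow>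
     bij_betw f V V' \<and> (\<forall>u\<in>V. \<forall>v\<in>V. (u, v) \<in> R \<longleftrightarrow> (f u, f v) \<in> R')"

text \<open>Building trees leaf by leaf makes rule induction the usual leaf-removal induction. Each
  edge is stored in both orientations.\<close>

inductive is_tree :: "'a set \<Rightarrow> 'a rel \<Rightarrow> bool" where
  single: "is_tree {r} {}"
| leaf: "is_tree V R \<Longrightarrow> w \<in> V \<Longrightarrow> v \<notin> V \<Longrightarrow>
    is_tree (insert v V) (insert (v, w) (insert (w, v) R))"

lemma is_treeD:
  assumes "is_tree V R"
  shows "finite V \<and> V \<noteq> {} \<and> sym R \<and> R \<subseteq> V \<times> V"
  using assms by induction (auto simp: sym_def)

lemma finite_convex_sets: "finite V \<Longrightarrow> finite (convex_sets V R)"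
  by (rule finite_subset[of _ "Pow V"]) (auto simp: convex_sets_def)

lemma finite_touching_sets: "finite V \<Longrightarrow> finite (touching_sets V R w)"
  by (simp add: touching_sets_def finite_convex_sets)

lemma subset_convex_sets: "S \<in> convex_sets V R \<Longrightarrow> S \<subseteq> V"
  by (simp add: convex_sets_def)

section \<open>Transport along isomorphisms\<close>

lemma rel_iso_convex_sets_iff:
  assumes "rel_iso f V R V' R'" "S \<subseteq> V"
  shows "f ` S \<in> convex_sets V' R' \<longleftrightarrow> S \<in> convex_sets V R"
proof -
  have V': "V' = f ` V" and inj: "inj_on f V"
    using assms by (auto simp: rel_iso_def bij_betw_def)
  have *: "f z \<in> f ` S \<longleftrightarrow> z \<in> S" if "z \<in> V" for z
    using inj_on_image_mem_iff[OF inj that assms(2)] .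
  have **: "(f x, f y) \<in> R' \<longleftrightarrow> (x, y) \<in> R" "f x = f y \<longleftrightarrow> x = y" if "x \<in> V" "y \<in> V" for x y
    using assms that inj by (auto simp: rel_iso_def inj_on_eq_iff)
  have "f ` S \<in> convex_sets V' R' \<longleftrightarrow> (\<forall>x\<in>S. \<forall>y\<in>S. \<forall>z\<in>V.
      (f x, f z) \<in> R' \<and> (f z, f y) \<in> R' \<and> f x \<noteq> f y \<longrightarrow> f z \<in> f ` S)"
    using image_mono[OF assms(2), of f] unfolding convex_sets_def V' by (simp del: image_iff)
  also have "\<dots> \<longleftrightarrow> (\<forall>x\<in>S. \<forall>y\<in>S. \<forall>z\<in>V. (x, z) \<in> R \<and> (z, y) \<in> R \<and> x \<noteq> y \<longrightarrow> z \<in> S)"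
    using subsetD[OF assms(2)] by (intro ball_cong refl) (simp only: * **)
  also have "\<dots> \<longleftrightarrow> S \<in> convex_sets V R"
    using assms(2) by (simp add: convex_sets_def)
  finally show ?thesis .
qed

lemma rel_iso_convex_sets:
  assumes "rel_iso f V R V' R'"
  shows "convex_sets V' R' = (`) f ` convex_sets V R"
proof (intro equalityI subsetI)
  fix S assume S: "S \<in> convex_sets V' R'"
  have "S = f ` {x \<in> V. f x \<in> S}"
    using subset_convex_sets[OF S] assms by (auto simp: rel_iso_def bij_betw_def)
  moreover from this have "{x \<in> V. f x \<in> S} \<in> convex_sets V R"
    using rel_iso_convex_sets_iff[OF assms, of "{x \<in> V. f x \<in> S}"] S by auto
  ultimately show "S \<in> (`) f ` convex_sets V R" by (rule image_eqI)
qed (use assms rel_iso_convex_sets_iff subset_convex_sets in fastforce)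

lemma rel_iso_touching_sets:
  assumes "rel_iso f V R V' R'" "w \<in> V"
  shows "touching_sets V' R' (f w) = (`) f ` touching_sets V R w"
proof -
  have *: "f w \<notin> f ` S \<longleftrightarrow> w \<notin> S" "(\<exists>x\<in>f ` S. (f w, x) \<in> R') \<longleftrightarrow> (\<exists>x\<in>S. (w, x) \<in> R)"
    if "S \<in> convex_sets V R" for S
    using assms subset_convex_sets[OF that]
    by (auto simp: rel_iso_def bij_betw_def subset_iff dest: inj_onD)
  then show ?thesis
    unfolding touching_sets_def rel_iso_convex_sets[OF assms(1)] Compr_image_eq
    by (intro arg_cong[where f = "image _"] Collect_cong conj_cong refl *)
qed

lemma rel_iso_inj_on_image: "rel_iso f V R V' R' \<Longrightarrow> A \<subseteq> Pow V \<Longrightarrow> inj_on ((`) f) A"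
  by (rule inj_on_subset[OF inj_on_image_Pow]) (auto simp: rel_iso_def bij_betw_def)

lemma rel_iso_card_convex_sets:
  assumes "rel_iso f V R V' R'"
  shows "card (convex_sets V' R') = card (convex_sets V R)"
  unfolding rel_iso_convex_sets[OF assms]
  by (rule card_image, rule rel_iso_inj_on_image[OF assms]) (auto simp: convex_sets_def)

lemma rel_iso_card_touching_sets:
  assumes "rel_iso f V R V' R'" "w \<in> V"
  shows "card (touching_sets V' R' (f w)) = card (touching_sets V R w)"
  unfolding rel_iso_touching_sets[OF assms]
  by (rule card_image, rule rel_iso_inj_on_image[OF assms(1)])
    (auto simp: convex_sets_def touching_sets_def)

lemma rel_iso_comp:
  assumes "rel_iso f V R V' R'" "rel_iso g V' R' V'' R''"
  shows "rel_iso (g \<circ> f) V R V'' R''"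
  using assms bij_betw_trans by (fastforce simp: rel_iso_def bij_betw_def)

lemma rel_iso_leaf:
  assumes f: "rel_iso f V R V' R'" and "w \<in> V" "v \<notin> V" "v' \<notin> V'" and R: "R \<subseteq> V \<times> V" "R' \<subseteq> V' \<times> V'"
  shows "rel_iso (f(v := v')) (insert v V) (insert (v, w) (insert (w, v) R))
    (insert v' V') (insert (v', f w) (insert (f w, v') R'))"
proof -
  have bij: "bij_betw f V V'" and adj: "\<And>u v. u \<in> V \<Longrightarrow> v \<in> V \<Longrightarrow> (u, v) \<in> R \<longleftrightarrow> (f u, f v) \<in> R'"
    using f by (auto simp: rel_iso_def)
  have [simp]: "f x \<noteq> v'" "f x \<in> V'" if "x \<in> V" for x
    using bij assms that by (auto simp: bij_betw_def)
  have [simp]: "f x = f y \<longleftrightarrow> x = y" if "x \<in> V" "y \<in> V" for x y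
    using bij that by (auto simp: bij_betw_def inj_on_eq_iff)
  have [simp]: "v \<noteq> x" "x \<noteq> v" if "x \<in> V" for x using assms that by auto
  have [simp]: "(v, x) \<notin> R" "(x, v) \<notin> R" "(v', y) \<notin> R'" "(y, v') \<notin> R'" for x y using assms by auto
  have "bij_betw (f(v := v')) (insert v V) (insert v' V')"
    using bij assms by (auto simp: bij_betw_def inj_on_def)
  then show ?thesis
    using assms(2,3,4) adj by (auto simp: rel_iso_def)
qed

section \<open>Attaching a leaf\<close>

text \<open>The leaf \<open>v\<close> has the single neighbour \<open>w\<close>, so it is never the
  middle of a path on three vertices, and it is an end only of paths
  \<open>v\<close>--\<open>w\<close>--\<open>x\<close>. Hence \<open>v\<close> may join a convex set
  unless that set contains a neighbour of \<open>w\<close> but not \<open>w\<close> itself.\<close>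

lemma convex_sets_leaf:
  assumes "sym R" "R \<subseteq> V \<times> V" "w \<in> V" "v \<notin> V"
  shows "convex_sets (insert v V) (insert (v, w) (insert (w, v) R)) =
    convex_sets V R \<union> insert v ` (convex_sets V R - touching_sets V R w)"
    (is "convex_sets _ ?R = ?A \<union> _ ` ?B")
proof -
  let ?L = "convex_sets (insert v V) ?R"
  have v: "(v, x) \<notin> R" "(x, v) \<notin> R" for x using assms by auto
  have A: "S \<in> ?L" if S: "S \<in> ?A" for S
  proof (rule convex_setsI)
    show "S \<subseteq> insert v V" using subset_convex_sets[OF S] by blast
    then have ne: "x \<noteq> v" if "x \<in> S" for x
      using that subset_convex_sets[OF S] assms(4) by blast
    fix x y z assume "x \<in> S" "y \<in> S" "(x, z) \<in> ?R" "(z, y) \<in> ?R" "x \<noteq> y"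
    then have "(x, z) \<in> R \<and> (z, y) \<in> R"
      using ne v assms(3,4) by auto
    then show "z \<in> S"
      using convex_setsD[OF S, of x y z] \<open>x \<in> S\<close> \<open>y \<in> S\<close> \<open>x \<noteq> y\<close> assms(2) by auto
  qed
  have A': "S \<in> ?A" if S: "S \<in> ?L" and "v \<notin> S" for S
  proof (rule convex_setsI)
    show "S \<subseteq> V" using subset_convex_sets[OF S] that(2) by blast
    fix x y z assume "x \<in> S" "y \<in> S" "z \<in> V" "(x, z) \<in> R" "(z, y) \<in> R" "x \<noteq> y"
    then show "z \<in> S" using convex_setsD[OF S, of x y z] by simp
  qed
  have B: "insert v S \<in> ?L" if "S \<in> ?B" for S
  proof -
    have S: "S \<in> ?A" and w: "x \<in> S \<Longrightarrow> (w, x) \<in> R \<Longrightarrow> w \<in> S" for x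
      using that by (auto simp: touching_sets_def)
    have w': "x \<in> S \<Longrightarrow> (x, w) \<in> R \<Longrightarrow> w \<in> S" for x
      using w assms(1) by (auto dest: symD)
    show ?thesis
    proof (rule convex_setsI)
      show "insert v S \<subseteq> insert v V" using subset_convex_sets[OF S] by blast
      fix x y z assume *: "x \<in> insert v S" "y \<in> insert v S" "(x, z) \<in> ?R" "(z, y) \<in> ?R" "x \<noteq> y"
      show "z \<in> insert v S"
      proof (cases "x = v \<or> y = v \<or> z = v")
        case True
        then show ?thesis using * v assms(3,4) by (auto intro: w w')
      next
        case False
        then show ?thesis
          using * convex_setsD[OF S, of x y z] assms(2) by auto
      qed
    qed
  qed
  have B': "S \<in> ?B" if L: "insert v S \<in> ?L" and "v \<notin> S" for S
  proof -
    have sub: "S \<subseteq> V" using subset_convex_sets[OF L] that(2) by auto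
    have "z \<in> insert v S" if "x \<in> S" "y \<in> S" "z \<in> V" "(x, z) \<in> R" "(z, y) \<in> R" "x \<noteq> y" for x y z
      using convex_setsD[OF L, of x y z] that by simp
    then have "S \<in> ?A"
      using assms(4) sub by (intro convex_setsI) blast+
    moreover have "w \<in> S" if "x \<in> S" "(w, x) \<in> R" for x
      using convex_setsD[OF L, of v x w] that assms(3,4) \<open>v \<notin> S\<close> by auto
    ultimately show ?thesis by (auto simp: touching_sets_def)
  qed
  show ?thesis
  proof (intro equalityI subsetI)
    fix S assume S: "S \<in> ?L"
    show "S \<in> ?A \<union> insert v ` ?B"
    proof (cases "v \<in> S")
      case True
      then have "S = insert v (S - {v})" by blast
      then show ?thesis using S B'[of "S - {v}"] by (metis Diff_iff UnI2 image_eqI insertI1)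
    qed (use S A' in blast)
  next
    fix S assume "S \<in> ?A \<union> insert v ` ?B"
    then show "S \<in> ?L" by (elim UnE imageE) (simp_all only: A B)
  qed
qed

text \<open>The two families of \<open>convex_sets_leaf\<close> are disjoint, since only the second
  has members containing \<open>v\<close>. The additive form avoids truncated subtraction.\<close>

lemma card_convex_sets_leaf:
  assumes "sym R" "R \<subseteq> V \<times> V" "w \<in> V" "v \<notin> V" "finite V"
  shows "card (convex_sets (insert v V) (insert (v, w) (insert (w, v) R))) +
    card (touching_sets V R w) = 2 * card (convex_sets V R)"
proof -
  let ?A = "convex_sets V R" and ?B = "touching_sets V R w"
  have v: "v \<notin> S" if "S \<in> ?A" for S
    using that assms(4) by (auto simp: convex_sets_def)
  have fin: "finite ?A" by (simp add: finite_convex_sets assms)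
  have sub: "?B \<subseteq> ?A" by (auto simp: touching_sets_def)
  have "inj_on (insert v) (?A - ?B)"
    by (rule inj_onI) (metis Diff_iff insert_ident v)
  moreover have "?A \<inter> insert v ` (?A - ?B) = {}" using v by auto
  ultimately show ?thesis
    unfolding convex_sets_leaf[OF assms(1-4)]
    using fin sub card_mono[OF fin sub]
    by (simp add: card_Un_disjoint card_image card_Diff_subset finite_subset[OF sub])
qed

lemma whole_convex_set: "V \<in> convex_sets V R"
  by (rule convex_setsI) auto

text \<open>These four ways to obtain touching sets of the enlarged tree supply every set needed for
  the lower bound on \<open>b\<close>.\<close>

lemma touching_sets_leaf:
  assumes "sym R" "R \<subseteq> V \<times> V" "w \<in> V" "v \<notin> V"
  defines "V' \<equiv> insert v V" and "R' \<equiv> insert (v, w) (insert (w, v) R)"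
  shows "x \<in> V \<Longrightarrow> S \<in> touching_sets V R x \<Longrightarrow> S \<in> touching_sets V' R' x"
    and "x \<in> V \<Longrightarrow> S \<in> touching_sets V R x \<Longrightarrow> w \<in> S \<Longrightarrow> insert v S \<in> touching_sets V' R' x"
    and "{v} \<in> touching_sets V' R' w"
    and "S \<in> convex_sets V R \<Longrightarrow> w \<in> S \<Longrightarrow> S \<in> touching_sets V' R' v"
proof -
  note C = convex_sets_leaf[OF assms(1-4), folded V'_def R'_def]
  have v: "v \<notin> S" if "S \<in> convex_sets V R" for S
    using subset_convex_sets[OF that] assms(4) by blast
  show "S \<in> touching_sets V' R' x" if "x \<in> V" "S \<in> touching_sets V R x"
    using that C by (auto simp: touching_sets_def R'_def)
  show "insert v S \<in> touching_sets V' R' x" if "x \<in> V" "S \<in> touching_sets V R x" "w \<in> S"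
  proof -
    \<comment> \<open>A set that contains \<open>w\<close> does not touch \<open>w\<close>, so
      \<open>v\<close> may join it.\<close>
    have "S \<in> convex_sets V R - touching_sets V R w" using that by (simp add: touching_sets_def)
    then have "insert v S \<in> convex_sets V' R'" unfolding C by blast
    then show ?thesis using that assms(4) by (auto simp: touching_sets_def R'_def)
  qed
  have "{} \<in> convex_sets V R - touching_sets V R w"
    by (auto simp: touching_sets_def convex_sets_def)
  then have "{v} \<in> convex_sets V' R'" unfolding C by blast
  then show "{v} \<in> touching_sets V' R' w"
    using assms(3,4) by (auto simp: touching_sets_def R'_def)
  show "S \<in> touching_sets V' R' v" if "S \<in> convex_sets V R" "w \<in> S"
    using that C v by (auto simp: touching_sets_def R'_def)
qed

section \<open>Paths and stars\<close>

text \<open>Since \<open>subseqs\<close> lists every subset exactly once, the number of subsets with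
  a decidable property becomes a list computation that \<open>code_simp\<close> can
  evaluate.\<close>

lemma card_subsets_filter:
  assumes "distinct xs"
  shows "card {S. S \<subseteq> set xs \<and> P S} = length (filter (\<lambda>ys. P (set ys)) (subseqs xs))"
proof -
  have d: "distinct (map set (subseqs xs))"
    using assms by (rule distinct_set_subseqs)
  have "{S. S \<subseteq> set xs \<and> P S} = set (filter P (map set (subseqs xs)))"
    using subseqs_powset[of xs] by (auto simp flip: set_map)
  then show ?thesis
    using d by (simp only: distinct_card distinct_filter) (simp add: filter_map comp_def)
qed

text \<open>Three-vertex paths in a path graph are consecutive triples, which gives an executable
  convexity test.\<close>

lemma convex_sets_path:
  "convex_sets {..<k} (parcs (path_graph k)) =
   {S. S \<subseteq> set [0..<k] \<and> (\<forall>x\<in>S. Suc (Suc x) \<in> S \<longrightarrow> Suc x \<in> S)}"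
proof -
  have "S \<in> convex_sets {..<k} (parcs (path_graph k)) \<longleftrightarrow> (\<forall>x\<in>S. Suc (Suc x) \<in> S \<longrightarrow> Suc x \<in> S)"
    if S: "S \<subseteq> {..<k}" for S
  proof
    assume C: "S \<in> convex_sets {..<k} (parcs (path_graph k))"
    show "\<forall>x\<in>S. Suc (Suc x) \<in> S \<longrightarrow> Suc x \<in> S"
    proof (intro ballI impI)
      fix x assume x: "x \<in> S" "Suc (Suc x) \<in> S"
      then have "Suc (Suc x) < k" using S by blast
      then show "Suc x \<in> S"
        using convex_setsD[OF C x, of "Suc x"] by (simp add: path_graph_def)
    qed
  next
    assume R: "\<forall>x\<in>S. Suc (Suc x) \<in> S \<longrightarrow> Suc x \<in> S"
    have "z \<in> S" if "x \<in> S" "y \<in> S" "(x, z) \<in> parcs (path_graph k)"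
      "(z, y) \<in> parcs (path_graph k)" "x \<noteq> y" for x y z
      using bspec[OF R, of x] bspec[OF R, of y] that by (auto simp: path_graph_def)
    with S show "S \<in> convex_sets {..<k} (parcs (path_graph k))"
      by (rule convex_setsI)
  qed
  then show ?thesis
    by (auto simp: atLeast0LessThan dest: subset_convex_sets)
qed

lemma touching_sets_path:
  "touching_sets {..<k} (parcs (path_graph k)) w =
   {S. S \<subseteq> set [0..<k] \<and> (\<forall>x\<in>S. Suc (Suc x) \<in> S \<longrightarrow> Suc x \<in> S) \<and>
     w \<notin> S \<and> w < k \<and> (\<exists>x\<in>S. x = Suc w \<or> w = Suc x)}"
proof -
  have "(\<exists>x\<in>S. (w, x) \<in> parcs (path_graph k)) \<longleftrightarrow> w < k \<and> (\<exists>x\<in>S. x = Suc w \<or> w = Suc x)"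
    if "S \<subseteq> {..<k}" for S
    using that by (auto simp: path_graph_def)
  then show ?thesis
    unfolding touching_sets_def convex_sets_path by (auto simp: atLeast0LessThan)
qed

lemma card_convex_sets_path4: "card (convex_sets {..<4} (parcs (path_graph 4))) = 12"
  unfolding convex_sets_path card_subsets_filter[OF distinct_upt] by code_simp

lemma card_convex_sets_path5: "card (convex_sets {..<5} (parcs (path_graph 5))) = 21"
  unfolding convex_sets_path card_subsets_filter[OF distinct_upt] by code_simp

text \<open>Four exceeds the permitted defect 4 - 1, so inner vertices of the path are ruled out as
  attachment points in the equality case.\<close>

lemma card_touching_sets_path4:
  "w \<in> {1, 2} \<Longrightarrow> card (touching_sets {..<4} (parcs (path_graph 4)) w) = 4"
  unfolding touching_sets_path card_subsets_filter[OF distinct_upt]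
  by (elim insertE emptyE; hypsubst; code_simp)

text \<open>Every vertex exceeds the permitted defect 5 - 1, so no equality case arises by extending
  this path.\<close>

lemma card_touching_sets_path5:
  assumes "w < 5"
  shows "card (touching_sets {..<5} (parcs (path_graph 5)) w) \<ge> 5"
proof -
  have "\<forall>w\<in>set [0..<5]. 5 \<le> card (touching_sets {..<5} (parcs (path_graph 5)) w)"
    unfolding touching_sets_path card_subsets_filter[OF distinct_upt] by code_simp
  then show ?thesis using assms by simp
qed

section \<open>Convex and touching sets of stars\<close>

lemma convex_sets_star:
  assumes "n \<ge> 1"
  shows "convex_sets {..<n} (parcs (star_graph n)) =
    insert 0 ` Pow {1..<n} \<union> insert {} ((\<lambda>i. {i}) ` {1..<n})" (is "?L = ?R")
proof (intro equalityI subsetI)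
  fix S assume S: "S \<in> ?L"
  then have sub: "S \<subseteq> {..<n}" by (rule subset_convex_sets)
  show "S \<in> ?R"
  proof (cases "0 \<in> S")
    case True
    then have "S = insert 0 (S - {0})" "S - {0} \<subseteq> {1..<n}" using sub by auto
    then show ?thesis by blast
  next
    case False
    have "x = y" if "x \<in> S" "y \<in> S" for x y
    proof (rule ccontr)
      assume "x \<noteq> y"
      moreover have "x \<noteq> 0" "y \<noteq> 0" "x < n" "y < n" using that False sub by (metis, metis, auto)
      \<comment> \<open>Two distinct leaves have the centre 0 as common neighbour, so a convex set
        without 0 has at most one element.\<close>
      ultimately show False
        using convex_setsD[OF S that, of 0] False by (simp add: star_graph_def)
    qed
    then consider "S = {}" | i where "S = {i}" by blast
    then show ?thesis using sub False by cases (auto simp: Suc_le_eq)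
  qed
next
  fix S assume "S \<in> ?R"
  then show "S \<in> ?L"
    using assms by (auto intro!: convex_setsI simp: star_graph_def)
qed

lemma inj_on_insert_Pow: "x \<notin> A \<Longrightarrow> inj_on (insert x) (Pow A)"
  by (rule inj_onI) (metis PowD insert_ident subsetD)

lemma card_convex_sets_star:
  assumes "n \<ge> 1"
  shows "card (convex_sets {..<n} (parcs (star_graph n))) = 2 ^ (n - 1) + n"
proof -
  have "card (insert 0 ` Pow {1..<n}) = 2 ^ (n - 1)"
    by (simp add: card_image inj_on_insert_Pow card_Pow)
  moreover have "card (insert {} ((\<lambda>i. {i}) ` {1..<n})) = n"
    using assms by (subst card_insert_disjoint) (auto simp: card_image)
  moreover have "insert 0 ` Pow {1..<n} \<inter> insert {} ((\<lambda>i. {i}) ` {1..<n}) = {}"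
    by auto
  ultimately show ?thesis
    unfolding convex_sets_star[OF assms] by (subst card_Un_disjoint) auto
qed

lemma card_touching_sets_star:
  assumes "0 < w" "w < n"
  shows "card (touching_sets {..<n} (parcs (star_graph n)) w) = 2 ^ (n - 2)"
proof -
  \<comment> \<open>The only neighbour of the leaf \<open>w\<close> is the centre, and every set
    containing the centre is convex; the other \<open>n - 2\<close> leaves are free.\<close>
  have "touching_sets {..<n} (parcs (star_graph n)) w = insert 0 ` Pow ({1..<n} - {w})"
  proof (intro equalityI subsetI)
    fix S assume "S \<in> touching_sets {..<n} (parcs (star_graph n)) w"
    then have S: "S \<subseteq> {..<n}" "w \<notin> S" "0 \<in> S"
      using assms by (auto simp: touching_sets_def star_graph_def dest!: subset_convex_sets)
    then have "S = insert 0 (S - {0})" "S - {0} \<subseteq> {1..<n} - {w}" by auto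
    then show "S \<in> insert 0 ` Pow ({1..<n} - {w})" by blast
  next
    fix S assume "S \<in> insert 0 ` Pow ({1..<n} - {w})"
    moreover from this have "S \<in> convex_sets {..<n} (parcs (star_graph n))"
      using assms by (subst convex_sets_star) auto
    ultimately show "S \<in> touching_sets {..<n} (parcs (star_graph n)) w"
      using assms by (auto simp: touching_sets_def star_graph_def)
  qed
  also have "card \<dots> = 2 ^ card ({1..<n} - {w})"
    by (subst card_image) (simp_all add: inj_on_insert_Pow card_Pow)
  also have "card ({1..<n} - {w}) = n - 2"
    using assms by (subst card_Diff_singleton) auto
  finally show ?thesis .
qed

section \<open>Trees\<close>

text \<open>The set to think of is the path from \<open>u\<close> towards \<open>w\<close>, stopped
  just before \<open>w\<close>; the induction only needs some such set, and may take all of the old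
  tree when \<open>w\<close> is the new leaf. The lemma serves both the lower bound on
  \<open>b\<close> and the strict loss caused by an edge outside a spanning tree.\<close>

lemma ex_touching_set:
  assumes "is_tree V R" "u \<in> V" "w \<in> V" "u \<noteq> w"
  shows "\<exists>S\<in>touching_sets V R w. u \<in> S"
  using assms
proof (induction arbitrary: u w)
  case (leaf V R x v)
  have R: "sym R" "R \<subseteq> V \<times> V" using is_treeD[OF leaf(1)] by auto
  note L = touching_sets_leaf[OF R leaf(2,3)]
  consider "w = v" | "w \<in> V" "u \<in> V" | "w \<in> V" "u = v" "w = x" | "w \<in> V" "u = v" "w \<noteq> x"
    using leaf.prems by blast
  then show ?case
  proof cases
    case 1
    then show ?thesis
      using L(4)[OF whole_convex_set leaf(2)] leaf.prems by blast
  next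
    case 2
    then show ?thesis using leaf.IH[of u w] L(1)[of w] leaf.prems by blast
  next
    case 3
    then show ?thesis using L(3) by blast
  next
    case 4
    then show ?thesis using leaf.IH[of x w] L(2)[of w] leaf.hyps by blast
  qed
qed simp

lemma card_ge_Suc_insert:
  assumes "m \<le> card A" "A \<subseteq> B" "T \<in> B" "T \<notin> A" "finite B"
  shows "Suc m \<le> card B"
proof -
  have "Suc (card A) \<le> card B"
    using assms card_mono[of B "insert T A"] finite_subset[of A B] by simp
  then show ?thesis using assms(1) by simp
qed

text \<open>The two bounds are proved together: the sets touching a new leaf \<open>v\<close>
  include all convex sets of the old tree through its neighbour \<open>w\<close>, so the second
  bound at \<open>v\<close> rests on the first at \<open>w\<close>.\<close>

lemma card_convex_touching_ge:
  assumes "is_tree V R" "x \<in> V"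
  shows "card V \<le> card {S \<in> convex_sets V R. x \<in> S} \<and> card V \<le> Suc (card (touching_sets V R x))"
  using assms
proof (induction arbitrary: x)
  case (single r)
  have "{S \<in> convex_sets {r} {}. r \<in> S} = {{r}}" by (auto simp: convex_sets_def)
  then show ?case using single by simp
next
  case (leaf V R w v)
  let ?V = "insert v V" and ?R = "insert (v, w) (insert (w, v) R)"
  have R: "sym R" "R \<subseteq> V \<times> V" and fin: "finite V" using is_treeD[OF leaf(1)] by auto
  note L = touching_sets_leaf[OF R leaf(2,3)] and C = convex_sets_leaf[OF R leaf(2,3)]
  have v: "v \<notin> S" if "S \<in> convex_sets V R" for S
    using subset_convex_sets[OF that] leaf(3) by blast
  have card: "card ?V = Suc (card V)" using fin leaf(3) by simp
  have whole: "?V \<in> convex_sets ?V ?R" by (rule whole_convex_set)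
  have finC: "finite {S \<in> convex_sets ?V ?R. x \<in> S}" and finT: "finite (touching_sets ?V ?R x)"
    using fin by (simp_all add: finite_convex_sets finite_touching_sets)
  show ?case
  proof (cases "x = v")
    case True
    let ?A = "insert v ` {S \<in> convex_sets V R. w \<in> S}"
    have "inj_on (insert v) {S \<in> convex_sets V R. w \<in> S}"
      by (rule inj_onI) (metis (no_types, lifting) insert_ident mem_Collect_eq v)
    then have "card V \<le> card ?A"
      using leaf.IH[OF leaf(2)] by (simp add: card_image)
    moreover have "?A \<subseteq> {S \<in> convex_sets ?V ?R. x \<in> S}"
      using True unfolding C by (auto simp: touching_sets_def)
    moreover have "{v} \<in> {S \<in> convex_sets ?V ?R. x \<in> S}"
      using L(3) True by (auto simp: touching_sets_def)
    \<comment> \<open>All members of \<open>?A\<close> contain \<open>w\<close>, so the singleton is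
      an additional set.\<close>
    moreover have "{v} \<notin> ?A" using leaf(2,3) by auto
    ultimately have 1: "Suc (card V) \<le> card {S \<in> convex_sets ?V ?R. x \<in> S}"
      using finC by (rule card_ge_Suc_insert)
    have "{S \<in> convex_sets V R. w \<in> S} \<subseteq> touching_sets ?V ?R x"
      using L(4) True by auto
    then have "card V \<le> card (touching_sets ?V ?R x)"
      using leaf.IH[OF leaf(2)] by (meson card_mono finT le_trans)
    with 1 show ?thesis using card by simp
  next
    case False
    then have x: "x \<in> V" using leaf.prems by simp
    have "card V \<le> card {S \<in> convex_sets V R. x \<in> S}" using leaf.IH[OF x] by simp
    moreover have "{S \<in> convex_sets V R. x \<in> S} \<subseteq> {S \<in> convex_sets ?V ?R. x \<in> S}"
      unfolding C by auto
    moreover have "?V \<in> {S \<in> convex_sets ?V ?R. x \<in> S}" using whole x by auto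
    moreover have "?V \<notin> {S \<in> convex_sets V R. x \<in> S}" using v by auto
    ultimately have 1: "Suc (card V) \<le> card {S \<in> convex_sets ?V ?R. x \<in> S}"
      using finC by (rule card_ge_Suc_insert)
    \<comment> \<open>A touching set containing the new vertex \<open>v\<close> cannot come from the
      old tree, so the count grows by at least one.\<close>
    obtain T where T: "T \<in> touching_sets ?V ?R x" "v \<in> T"
      using ex_touching_set[OF is_tree.leaf[OF leaf(1-3)], of v x] x False by blast
    have "card V - 1 \<le> card (touching_sets V R x)" using leaf.IH[OF x] by arith
    moreover have "touching_sets V R x \<subseteq> touching_sets ?V ?R x" using L(1)[OF x] by blast
    moreover note T(1)
    moreover have "T \<notin> touching_sets V R x" using T(2) v by (auto simp: touching_sets_def)
    ultimately have "Suc (card V - 1) \<le> card (touching_sets ?V ?R x)"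
      using finT by (rule card_ge_Suc_insert)
    with 1 show ?thesis using card by simp
  qed
qed

section \<open>Trees attaining the bound\<close>

definition extremal :: "'a set \<Rightarrow> 'a rel \<Rightarrow> bool" where
  "extremal V R \<longleftrightarrow> (\<exists>f. rel_iso f V R {..<card V} (parcs (star_graph (card V))) \<or>
     rel_iso f V R {..<4} (parcs (path_graph 4)) \<or> rel_iso f V R {..<5} (parcs (path_graph 5)))"

lemma rel_iso_card: "rel_iso f V R V' R' \<Longrightarrow> card V = card V'"
  by (auto simp: rel_iso_def bij_betw_same_card)

lemma card_convex_sets_extremal:
  assumes "extremal V R" "finite V" "V \<noteq> {}"
  shows "card (convex_sets V R) = 2 ^ (card V - 1) + card V"
proof -
  have "card V \<ge> 1" using assms(2,3) by (simp add: Suc_le_eq card_gt_0_iff)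
  from assms(1) obtain f where "rel_iso f V R {..<card V} (parcs (star_graph (card V))) \<or>
     rel_iso f V R {..<4} (parcs (path_graph 4)) \<or> rel_iso f V R {..<5} (parcs (path_graph 5))"
    unfolding extremal_def by blast
  then show ?thesis
    using card_convex_sets_star[OF \<open>card V \<ge> 1\<close>] card_convex_sets_path4 card_convex_sets_path5
    by (elim disjE) (auto dest!: rel_iso_card simp flip: rel_iso_card_convex_sets)
qed

text \<open>At a leaf of a star on \<open>m\<close> vertices the defect is
  \<open>2 ^ (m - 2)\<close>; it outgrows the permitted \<open>m - 1\<close> from
  \<open>m = 4\<close> on.\<close>

lemma two_power_le_imp_le_3:
  assumes "2 ^ (m - 2) \<le> m - 1"
  shows "m \<le> (3::nat)"
proof (rule ccontr)
  assume "\<not> m \<le> 3"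
  then obtain k where "m = 4 + k" using le_Suc_ex[of 4 m] by auto
  moreover have "k + 4 \<le> 2 ^ (k + 2)" by (induction k) auto
  ultimately show False using assms by simp
qed

text \<open>The admissible attachments are: the centre of a star, giving a larger star; a leaf of
  the two-vertex star, giving the three-vertex star; a leaf of the three-vertex star, giving
  \<open>P\<^sub>4\<close>; and an end of \<open>P\<^sub>4\<close>, giving
  \<open>P\<^sub>5\<close>.\<close>

lemma extremal_leaf:
  assumes "extremal V R" and tree: "is_tree V R" and w: "w \<in> V" and v: "v \<notin> V"
    and le: "card (touching_sets V R w) \<le> card V - 1"
  shows "extremal (insert v V) (insert (v, w) (insert (w, v) R))"
proof -
  let ?V = "insert v V" and ?R = "insert (v, w) (insert (w, v) R)"
  have fin: "finite V" and R: "R \<subseteq> V \<times> V" using is_treeD[OF tree] by auto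
  have card: "card ?V = Suc (card V)" using fin v by simp
  \<comment> \<open>The attachment is carried to the model graph on \<open>{..<k}\<close>, where the
    new leaf is called \<open>k\<close>; then \<open>g\<close> relabels the result.\<close>
  have ext: "\<exists>h. rel_iso h ?V ?R W Q"
    if "rel_iso f V R {..<k} R'" "R' \<subseteq> {..<k} \<times> {..<k}"
      "rel_iso g (insert k {..<k}) (insert (k, f w) (insert (f w, k) R')) W Q"
    for f :: "'a \<Rightarrow> nat" and k R' and g :: "nat \<Rightarrow> nat" and W Q
    using rel_iso_comp[OF rel_iso_leaf[OF that(1) w v _ R that(2)] that(3)] by auto
  have star: "parcs (star_graph k) \<subseteq> {..<k} \<times> {..<k}"
    and path: "parcs (path_graph k) \<subseteq> {..<k} \<times> {..<k}" for k
    by (auto simp: star_graph_def path_graph_def)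
  from assms(1) obtain f where "rel_iso f V R {..<card V} (parcs (star_graph (card V))) \<or>
     rel_iso f V R {..<4} (parcs (path_graph 4)) \<or> rel_iso f V R {..<5} (parcs (path_graph 5))"
    unfolding extremal_def by blast
  then consider (star) "rel_iso f V R {..<card V} (parcs (star_graph (card V)))"
    | (path4) "rel_iso f V R {..<4} (parcs (path_graph 4))"
    | (path5) "rel_iso f V R {..<5} (parcs (path_graph 5))" by blast
  then show ?thesis
  proof cases
    case star
    then have fw: "f w < card V" using w by (auto simp: rel_iso_def bij_betw_def)
    show ?thesis
    proof (cases "f w = 0")
      case True
      have "rel_iso id (insert (card V) {..<card V})
          (insert (card V, f w) (insert (f w, card V) (parcs (star_graph (card V)))))
          {..<card ?V} (parcs (star_graph (card ?V)))"
        using fw unfolding True card by (auto simp: rel_iso_def bij_betw_def star_graph_def)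
      then show ?thesis using ext[OF star \<open>\<And>k. parcs (star_graph k) \<subseteq> _\<close>] unfolding extremal_def by blast
    next
      case False
      then have "2 ^ (card V - 2) \<le> card V - 1"
        using le card_touching_sets_star[OF _ fw] rel_iso_card_touching_sets[OF star w] by simp
      then have "card V \<le> 3" by (rule two_power_le_imp_le_3)
      then consider "card V = 2" "f w = 1" | "card V = 3" "f w = 1" | "card V = 3" "f w = 2"
        using fw False by linarith
      then show ?thesis
      proof cases
        case 1
        \<comment> \<open>Entry \<open>i\<close> of the list is the image of vertex
          \<open>i\<close>. The new graph is the path 0--1--2, so its middle vertex 1 must become
          the centre 0.\<close>
        then have "rel_iso ((!) [1, 0, 2]) (insert (card V) {..<card V})
          (insert (card V, f w) (insert (f w, card V) (parcs (star_graph (card V)))))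
          {..<card ?V} (parcs (star_graph (card ?V)))"
          unfolding card by (auto simp: rel_iso_def bij_betw_def star_graph_def numeral_eq_Suc lessThan_Suc)
        then show ?thesis using ext[OF star \<open>\<And>k. parcs (star_graph k) \<subseteq> _\<close>] unfolding extremal_def by blast
      next
        case 2
        \<comment> \<open>The path is 2--0--1--3, and the list gives each vertex its position; the
          next case has 1--0--2--3.\<close>
        then have "rel_iso ((!) [1, 2, 0, 3]) (insert (card V) {..<card V})
          (insert (card V, f w) (insert (f w, card V) (parcs (star_graph (card V)))))
          {..<4} (parcs (path_graph 4))"
          by (auto simp: rel_iso_def bij_betw_def star_graph_def path_graph_def numeral_eq_Suc lessThan_Suc)
        then show ?thesis using ext[OF star \<open>\<And>k. parcs (star_graph k) \<subseteq> _\<close>] unfolding extremal_def by blast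
      next
        case 3
        then have "rel_iso ((!) [1, 0, 2, 3]) (insert (card V) {..<card V})
          (insert (card V, f w) (insert (f w, card V) (parcs (star_graph (card V)))))
          {..<4} (parcs (path_graph 4))"
          by (auto simp: rel_iso_def bij_betw_def star_graph_def path_graph_def numeral_eq_Suc lessThan_Suc)
        then show ?thesis using ext[OF star \<open>\<And>k. parcs (star_graph k) \<subseteq> _\<close>] unfolding extremal_def by blast
      qed
    qed
  next
    case path4
    have "f w < 4" "card V = 4"
      using path4 w rel_iso_card[OF path4] by (auto simp: rel_iso_def bij_betw_def)
    moreover from this have "f w \<notin> {1, 2}"
      using le card_touching_sets_path4[of "f w"] rel_iso_card_touching_sets[OF path4 w] by auto
    ultimately consider "f w = 0" | "f w = 3" by fastforce
    then show ?thesis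
    proof cases
      case 1
      \<comment> \<open>The new vertex 4 precedes 0 on the path, so all old labels shift by
        one.\<close>
      then have "rel_iso ((!) [1, 2, 3, 4, 0]) (insert 4 {..<4})
          (insert (4, f w) (insert (f w, 4) (parcs (path_graph 4)))) {..<5} (parcs (path_graph 5))"
        by (auto simp: rel_iso_def bij_betw_def path_graph_def numeral_eq_Suc lessThan_Suc)
      then show ?thesis using ext[OF path4 path] unfolding extremal_def by blast
    next
      case 2
      then have "rel_iso id (insert 4 {..<4})
          (insert (4, f w) (insert (f w, 4) (parcs (path_graph 4)))) {..<5} (parcs (path_graph 5))"
        by (auto simp: rel_iso_def bij_betw_def path_graph_def)
      then show ?thesis using ext[OF path4 path] unfolding extremal_def by blast
    qed
  next
    case path5
    have "f w < 5" "card V = 5"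
      using path5 w rel_iso_card[OF path5] by (auto simp: rel_iso_def bij_betw_def)
    then show ?thesis
      using le card_touching_sets_path5[of "f w"] rel_iso_card_touching_sets[OF path5 w] by simp
  qed
qed

lemma card_convex_sets_tree:
  assumes "is_tree V R"
  shows "card (convex_sets V R) \<le> 2 ^ (card V - 1) + card V \<and>
    (card (convex_sets V R) = 2 ^ (card V - 1) + card V \<longrightarrow> extremal V R)"
  using assms
proof induction
  case (single r)
  have "convex_sets {r} {} = {{}, {r}}" by (auto simp: convex_sets_def)
  moreover have "rel_iso (\<lambda>_. 0) {r} {} {..<1} (parcs (star_graph 1))"
    by (auto simp: rel_iso_def bij_betw_def star_graph_def)
  ultimately show ?case by (auto simp: extremal_def)
next
  case (leaf V R w v)
  let ?V = "insert v V" and ?R = "insert (v, w) (insert (w, v) R)"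
  have V: "finite V" "V \<noteq> {}" "sym R" "R \<subseteq> V \<times> V" using is_treeD[OF leaf(1)] by auto
  obtain m where m: "card V = Suc m" using V(1,2) by (metis card_gt_0_iff gr0_implies_Suc)
  have card: "card ?V = Suc (Suc m)" using V(1) leaf(3) m by simp
  have 1: "card (convex_sets ?V ?R) + card (touching_sets V R w) = 2 * card (convex_sets V R)"
    using V leaf by (intro card_convex_sets_leaf)
  have 2: "m \<le> card (touching_sets V R w)"
    using card_convex_touching_ge[OF leaf(1,2)] m by simp
  have 3: "card (convex_sets V R) \<le> 2 ^ m + Suc m"
    using leaf.IH m by simp
  \<comment> \<open>By facts 1 to 3 the count is at most \<open>2 * (2 ^ m + Suc m) - m\<close>,
    which is the claimed bound; equality therefore forces equality in both 2 and 3.\<close>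
  have "extremal ?V ?R" if "card (convex_sets ?V ?R) = 2 ^ Suc m + Suc (Suc m)"
  proof (rule extremal_leaf)
    have "card (convex_sets V R) = 2 ^ m + Suc m" using that 1 2 3 by simp
    then show "extremal V R" using leaf.IH m by simp
    show "card (touching_sets V R w) \<le> card V - 1" using that 1 2 3 m by simp
  qed (use leaf in auto)
  then show ?case using card 1 2 3 by simp
qed

section \<open>Connected graphs\<close>

lemma card_convex_sets_less:
  assumes "is_tree V T" "T \<subset> R" "R \<subseteq> V \<times> V" "irrefl R"
  shows "card (convex_sets V R) < card (convex_sets V T)"
proof (rule psubset_card_mono)
  show "finite (convex_sets V T)" using is_treeD[OF assms(1)] by (simp add: finite_convex_sets)
  obtain x y where xy: "(x, y) \<in> R" "(x, y) \<notin> T" using assms(2) by auto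
  then have V: "x \<in> V" "y \<in> V" "x \<noteq> y" using assms(3,4) by (auto simp: irrefl_def)
  then obtain S where S: "S \<in> touching_sets V T x" "y \<in> S"
    using ex_touching_set[OF assms(1), of y x] by auto
  then obtain z where z: "z \<in> S" "(x, z) \<in> T" by (auto simp: touching_sets_def)
  \<comment> \<open>Since \<open>(x, z)\<close> is in \<open>T\<close> and \<open>(x, y)\<close> is
    not, \<open>z\<close>--\<open>x\<close>--\<open>y\<close> is a genuine path in \<open>R\<close>
    whose ends lie in \<open>S\<close> and whose middle does not.\<close>
  then have "(z, x) \<in> R" "z \<noteq> y" using is_treeD[OF assms(1)] assms(2) xy by (auto dest: symD)
  then have "S \<notin> convex_sets V R"
    using convex_setsD[of S V R z y x] z S xy V by (auto simp: touching_sets_def)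
  moreover have "S \<in> convex_sets V T" using S by (simp add: touching_sets_def)
  moreover have "convex_sets V R \<subseteq> convex_sets V T"
  proof
    fix S assume S: "S \<in> convex_sets V R"
    show "S \<in> convex_sets V T"
    proof (rule convex_setsI)
      fix x y z assume "x \<in> S" "y \<in> S" "z \<in> V" "(x, z) \<in> T" "(z, y) \<in> T" "x \<noteq> y"
      then show "z \<in> S" using convex_setsD[OF S, of x y z] assms(2) by blast
    qed (rule subset_convex_sets[OF S])
  qed
  ultimately show "convex_sets V R \<subset> convex_sets V T" by blast
qed

text \<open>A subtree is grown one leaf at a time: while it misses a vertex, connectedness provides
  an edge leaving it.\<close>

lemma ex_spanning_tree:
  assumes "finite V" "V \<noteq> {}" "sym R" "R \<subseteq> V \<times> V" and conn: "\<And>u v. u \<in> V \<Longrightarrow> v \<in> V \<Longrightarrow> (u, v) \<in> R\<^sup>*"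
  shows "\<exists>T\<subseteq>R. is_tree V T"
proof -
  have "\<exists>W T. W \<subseteq> V \<and> T \<subseteq> R \<and> is_tree W T \<and> card W = Suc k" if "Suc k \<le> card V" for k
    using that
  proof (induction k)
    case 0
    then show ?case using assms(2) is_tree.single by (metis all_not_in_conv card_1_singleton_iff
        empty_subsetI insert_subset)
  next
    case (Suc k)
    then obtain W T where W: "W \<subseteq> V" "T \<subseteq> R" "is_tree W T" "card W = Suc k" by auto
    then obtain u where u: "u \<in> W" by fastforce
    obtain v where v: "v \<in> V" "v \<notin> W" using W Suc.prems
      by (metis Suc_n_not_le_n subsetI card_mono assms(1) subset_antisym)
    \<comment> \<open>If no edge left \<open>W\<close>, then \<open>W\<close> would contain
      everything reachable from \<open>u\<close>, including \<open>v\<close>.\<close>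
    have "\<not> R `` W \<subseteq> W"
    proof
      assume "R `` W \<subseteq> W"
      then have "R\<^sup>* `` W = W" by (rule Image_closed_trancl)
      moreover have "(u, v) \<in> R\<^sup>*" using u v W(1) by (intro conn) auto
      ultimately show False using u v by blast
    qed
    then obtain a b where ab: "a \<in> W" "b \<notin> W" "(a, b) \<in> R" by blast
    let ?W = "insert b W" and ?T = "insert (b, a) (insert (a, b) T)"
    have "is_tree ?W ?T" using W(3) ab(1,2) by (rule is_tree.leaf)
    moreover have "card ?W = Suc (Suc k)" using ab(2) W is_treeD[OF W(3)] by simp
    moreover have "?W \<subseteq> V" "?T \<subseteq> R" using ab W assms(3,4) by (auto dest: symD)
    ultimately show ?case by blast
  qed
  from this[of "card V - 1"] obtain W T where W: "W \<subseteq> V" "T \<subseteq> R" "is_tree W T" "card W = card V"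
    using assms(1,2) by (auto simp: card_gt_0_iff)
  then show ?thesis using card_subset_eq[OF assms(1)] by metis
qed

lemma card_convex_sets_connected:
  assumes "finite V" "V \<noteq> {}" "sym R" "irrefl R" "R \<subseteq> V \<times> V"
    and "\<And>u v. u \<in> V \<Longrightarrow> v \<in> V \<Longrightarrow> (u, v) \<in> R\<^sup>*"
  shows "card (convex_sets V R) \<le> 2 ^ (card V - 1) + card V \<and>
    (card (convex_sets V R) = 2 ^ (card V - 1) + card V \<longleftrightarrow> extremal V R)"
proof -
  obtain T where T: "T \<subseteq> R" "is_tree V T"
    using ex_spanning_tree[OF assms(1-3,5,6)] by blast
  have "card (convex_sets V R) < card (convex_sets V T)" if "T \<noteq> R"
    using that T assms by (intro card_convex_sets_less) auto
  \<comment> \<open>Equality thus forces the graph to be its own spanning tree, which reduces the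
    characterization to trees.\<close>
  then have "T = R \<or> card (convex_sets V R) < 2 ^ (card V - 1) + card V"
    using card_convex_sets_tree[OF T(2)] by fastforce
  then show ?thesis
    using card_convex_sets_tree[OF T(2)] card_convex_sets_extremal[of V R] assms(1,2) by auto
qed

section \<open>Transfer to digraphs\<close>

theorem theorem2p13:
  fixes G :: "('a, 'b) pre_digraph" and n :: nat
  assumes "graph G" and "connected G" and "card (verts G) = n" and "n \<ge> 1"
  shows "noc G \<le> 2 ^ (n - 1) + n \<and>
    (noc G = 2 ^ (n - 1) + n \<longleftrightarrow>
       digraph_iso G (with_proj (star_graph n)) \<or>
       digraph_iso G (with_proj (path_graph 4)) \<or>
       digraph_iso G (with_proj (path_graph 5)))"
proof -
  interpret graph G by fact
  have sym: "sym (arcs_ends G)"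
    using sym_arcs by (simp add: symmetric_def)
  have "card (convex_sets (verts G) (arcs_ends G)) \<le> 2 ^ (card (verts G) - 1) + card (verts G) \<and>
    (card (convex_sets (verts G) (arcs_ends G)) = 2 ^ (card (verts G) - 1) + card (verts G) \<longleftrightarrow>
      extremal (verts G) (arcs_ends G))"
  proof (rule card_convex_sets_connected)
    show "verts G \<noteq> {}" using assms(3,4) by auto
    show "irrefl (arcs_ends G)" by (auto simp: irrefl_def dest: adj_not_same)
    show "arcs_ends G \<subseteq> verts G \<times> verts G" by (auto dest: adj_in_verts)
    have "symcl (arcs_ends G) = arcs_ends G" using sym by (auto simp: symcl_def dest: symD)
    moreover have "strongly_connected G"
      using assms(2) by (rule symmetric_connected_imp_strongly_connected[OF sym_arcs])
    ultimately show "(u, v) \<in> (arcs_ends G)\<^sup>*" if "u \<in> verts G" "v \<in> verts G" for u v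
      using that by (auto simp: strongly_connected_def intro: reachable_rtranclI)
  qed (use sym in auto)
  moreover have "noc G = card (convex_sets (verts G) (arcs_ends G))"
  proof -
    have "P3_convex G S \<longleftrightarrow> S \<in> convex_sets (verts G) (arcs_ends G)" for S
    proof
      assume P: "P3_convex G S"
      show "S \<in> convex_sets (verts G) (arcs_ends G)"
      proof (rule convex_setsI)
        show "S \<subseteq> verts G" using P by (simp add: P3_convex_def)
        fix x y z assume "x \<in> S" "y \<in> S" "x \<rightarrow>\<^bsub>G\<^esub> z" "z \<rightarrow>\<^bsub>G\<^esub> y" "x \<noteq> y"
        then show "z \<in> S"
          using P[unfolded P3_convex_def, THEN conjunct2, rule_format, of x z y]
          by (cases "z = x \<or> z = y") auto
      qed
    next
      assume S: "S \<in> convex_sets (verts G) (arcs_ends G)"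
      have "z \<in> S" if "distinct [x, z, y]" "x \<rightarrow>\<^bsub>G\<^esub> z" "z \<rightarrow>\<^bsub>G\<^esub> y" "x \<in> S" "y \<in> S" for x y z
        using convex_setsD[OF S that(4,5) _ that(2,3)] adj_in_verts[OF that(2)] that(1) by simp
      then show "P3_convex G S"
        using subset_convex_sets[OF S] unfolding P3_convex_def by blast
    qed
    then show ?thesis by (simp add: noc_def)
  qed
  \<comment> \<open>The vertex criterion for isomorphism of simple graphs is literally
    \<open>rel_iso\<close>.\<close>
  moreover have "digraph_iso G (with_proj H) \<longleftrightarrow> (\<exists>f. rel_iso f (verts G) (arcs_ends G) (pverts H) (parcs H))"
    if "pair_graph H" for H :: "nat pair_pre_digraph"
    unfolding digraph_iso_pair_graph_iff[OF assms(1) that] rel_iso_def by blast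
  ultimately show ?thesis
    using assms(3) pair_graph_star_graph[of n] pair_graph_path_graph[of 4] pair_graph_path_graph[of 5]
    by (simp add: extremal_def ex_disj_distrib) (simp add: star_graph_def path_graph_def)
qed

end
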